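(* Let $X$ be a real Banach space with $\dim X\ge 2$. For every free ultrafilter $\mathcal U$ on $\mathbb N$, $$\mathrm{DR}_B(X_{\mathcal U})=\mathrm{DR}_B(X).$$
   Context: The ultrapower $X_{\mathcal U}$ is the quotient of $\ell_\infty(X)$ by the closed subspace of sequences $(x_n)$ satisfying $\lim_{\mathcal U}\|x_n\|=0$, with norm $\|(x_n)_{\mathcal U}\|=\lim_{\mathcal U}\|x_n\|$. Birkhoff orthogonality: $x\perp_B y$ iff $\|x+\lambda y\|\ge\|x\|$ for all $\lambda\in\mathbb R$. For nonzero $x,y$ in a real Banach space $Z$ put $\alpha[x,y]=\left\|\frac{x}{\|x\|}-\frac{y}{\|y\|}\right\|$ and $\beta[x,y]=\left\|\frac{x}{\|y\|}-\frac{y}{\|x\|}\right\|$, and $$\mathrm{DR}_B(Z)=\sup\left\{\frac{\alpha[x,y]}{\beta[x,y]}: x,y\in Z\setminus\{0\},\ x\perp_B y,\ \beta[x,y]\ne 0\right\}.$$ *)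

theory Defs
  imports "HOL-Analysis.Analysis"
begin

(* An ultrapower depends on the ultrafilter, hence cannot be a type of class real_normed_vector.
   The constants below are therefore stated for normed spaces given by an explicit carrier and
   operations, so that one definition of DR_B serves both X and its ultrapowers. *)

record 'z normed_structure =
  ns_carrier :: "'z set"
  ns_zero :: 'z
  ns_add :: "'z \<Rightarrow> 'z \<Rightarrow> 'z"
  ns_scale :: "real \<Rightarrow> 'z \<Rightarrow> 'z"
  ns_norm :: "'z \<Rightarrow> real"

definition ns_diff :: "('z, 'm) normed_structure_scheme \<Rightarrow> 'z \<Rightarrow> 'z \<Rightarrow> 'z" where
  "ns_diff Z x y = ns_add Z x (ns_scale Z (-1) y)"

definition birkhoff_orth :: "('z, 'm) normed_structure_scheme \<Rightarrow> 'z \<Rightarrow> 'z \<Rightarrow> bool" where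
  "birkhoff_orth Z x y \<longleftrightarrow>
     (\<forall>l::real. ns_norm Z (ns_add Z x (ns_scale Z l y)) \<ge> ns_norm Z x)"

definition DR_alpha :: "('z, 'm) normed_structure_scheme \<Rightarrow> 'z \<Rightarrow> 'z \<Rightarrow> real" where
  "DR_alpha Z x y =
     ns_norm Z (ns_diff Z (ns_scale Z (1 / ns_norm Z x) x) (ns_scale Z (1 / ns_norm Z y) y))"

definition DR_beta :: "('z, 'm) normed_structure_scheme \<Rightarrow> 'z \<Rightarrow> 'z \<Rightarrow> real" where
  "DR_beta Z x y =
     ns_norm Z (ns_diff Z (ns_scale Z (1 / ns_norm Z y) x) (ns_scale Z (1 / ns_norm Z x) y))"

(* The supremum is taken in the extended reals, so that it is meaningful without a
   boundedness side condition. *)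

definition DR_B :: "('z, 'm) normed_structure_scheme \<Rightarrow> ereal" where
  "DR_B Z = Sup {ereal (DR_alpha Z x y / DR_beta Z x y) | x y.
     x \<in> ns_carrier Z - {ns_zero Z} \<and> y \<in> ns_carrier Z - {ns_zero Z} \<and>
     birkhoff_orth Z x y \<and> DR_beta Z x y \<noteq> 0}"

definition type_space :: "'a::real_normed_vector normed_structure" where
  "type_space = \<lparr>ns_carrier = UNIV, ns_zero = 0, ns_add = (+), ns_scale = scaleR, ns_norm = norm\<rparr>"

(* Freeness: the members of U have empty intersection. *)

definition free_ultrafilter :: "'i filter \<Rightarrow> bool" where
  "free_ultrafilter U \<longleftrightarrow>
     U \<noteq> bot \<and>
     (\<forall>P. eventually P U \<or> eventually (\<lambda>i. \<not> P i) U) \<and>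
     (\<forall>j. eventually (\<lambda>i. i \<noteq> j) U)"

(* The topology of nat is discrete, so bounded continuous functions on nat are exactly the
   bounded sequences. *)

type_synonym 'a linf = "nat \<Rightarrow>\<^sub>C 'a"

definition null_subspace :: "nat filter \<Rightarrow> 'a::real_normed_vector linf set" where
  "null_subspace U = {x. ((\<lambda>n. norm (apply_bcontfun x n)) \<longlongrightarrow> 0) U}"

definition ultra_rel :: "nat filter \<Rightarrow> ('a::real_normed_vector linf \<times> 'a linf) set" where
  "ultra_rel U = {(x, y). x - y \<in> null_subspace U}"

abbreviation ultra_class :: "nat filter \<Rightarrow> 'a::real_normed_vector linf \<Rightarrow> 'a linf set" where
  "ultra_class U x \<equiv> ultra_rel U `` {x}"

(* The operations on classes are lifted from representatives; independence of the chosen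
   representatives is established below. *)

definition ultrapower :: "nat filter \<Rightarrow> 'a::real_normed_vector linf set normed_structure" where
  "ultrapower U =
     \<lparr>ns_carrier = UNIV // ultra_rel U,
      ns_zero = ultra_class U 0,
      ns_add = (\<lambda>A B. \<Union>x\<in>A. \<Union>y\<in>B. ultra_class U (x + y)),
      ns_scale = (\<lambda>c A. \<Union>x\<in>A. ultra_class U (c *\<^sub>R x)),
      ns_norm = (\<lambda>A. the_elem ((\<lambda>x. Lim U (\<lambda>n. norm (apply_bcontfun x n))) ` A))\<rparr>"

lemma in_linf_iff: "f \<in> (bcontfun :: (nat \<Rightarrow> 'a::metric_space) set) \<longleftrightarrow> bounded (range f)"
  by (simp add: bcontfun_def)

lemma null_subspace_iff: "x \<in> null_subspace U \<longleftrightarrow> (apply_bcontfun x \<longlongrightarrow> 0) U"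
  unfolding null_subspace_def by (simp add: tendsto_norm_zero_iff)

lemma subspace_null_subspace: "subspace (null_subspace U)"
proof (rule subspaceI)
  show "0 \<in> null_subspace U"
    by (simp add: null_subspace_iff zero_bcontfun.rep_eq)
  show "x + y \<in> null_subspace U" if "x \<in> null_subspace U" "y \<in> null_subspace U" for x y
    using tendsto_add_zero that by (simp add: null_subspace_iff plus_bcontfun.rep_eq)
  show "c *\<^sub>R x \<in> null_subspace U" if "x \<in> null_subspace U" for c x
    using tendsto_scaleR[OF tendsto_const[of c], of "apply_bcontfun x" 0 U] that
    by (simp add: null_subspace_iff scaleR_bcontfun.rep_eq)
qed

lemma ultra_rel_iff: "(x, y) \<in> ultra_rel U \<longleftrightarrow> x - y \<in> null_subspace U"
  by (simp add: ultra_rel_def)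

lemma equiv_ultra_rel: "equiv UNIV (ultra_rel U)"
proof (rule equivI)
  show "refl (ultra_rel U)"
    by (auto simp: refl_on_def ultra_rel_iff subspace_0[OF subspace_null_subspace])
  show "sym (ultra_rel U)"
    using subspace_neg[OF subspace_null_subspace]
    by (fastforce simp: sym_def ultra_rel_iff)
  show "trans (ultra_rel U)"
    using subspace_add[OF subspace_null_subspace]
    by (fastforce simp: trans_def ultra_rel_iff)
qed simp

lemma ultra_class_eq_iff: "ultra_class U x = ultra_class U y \<longleftrightarrow> x - y \<in> null_subspace U"
  using eq_equiv_class_iff[OF equiv_ultra_rel, of x y U] by (simp add: ultra_rel_iff)

lemma ultrapower_carrier: "ns_carrier (ultrapower U) = range (ultra_class U)"
  by (auto simp: ultrapower_def quotient_def)

lemma ultrapower_zero: "ns_zero (ultrapower U) = ultra_class U 0"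
  by (simp add: ultrapower_def)

lemma ultrapower_add:
  "ns_add (ultrapower U) (ultra_class U x) (ultra_class U y) = ultra_class U (x + y)"
proof -
  have "congruent2 (ultra_rel U) (ultra_rel U) (\<lambda>x y. ultra_class U (x + y))"
  proof (rule congruent2I[OF equiv_ultra_rel equiv_ultra_rel])
    show "ultra_class U (y + z) = ultra_class U (y' + z)" if "(y, y') \<in> ultra_rel U" for y y' z
      using that by (simp add: ultra_class_eq_iff ultra_rel_iff)
    show "ultra_class U (z + y) = ultra_class U (z + y')" if "(y, y') \<in> ultra_rel U" for y y' z
      using that by (simp add: ultra_class_eq_iff ultra_rel_iff)
  qed
  from UN_equiv_class2[OF equiv_ultra_rel equiv_ultra_rel this, of x y]
  show ?thesis by (simp add: ultrapower_def)
qed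

lemma ultrapower_scale:
  "ns_scale (ultrapower U) c (ultra_class U x) = ultra_class U (c *\<^sub>R x)"
proof -
  have "congruent (ultra_rel U) (\<lambda>x. ultra_class U (c *\<^sub>R x))"
    using subspace_scale[OF subspace_null_subspace]
    by (intro congruentI)
       (simp add: ultra_class_eq_iff ultra_rel_iff flip: scaleR_diff_right)
  from UN_equiv_class[OF equiv_ultra_rel this, of x]
  show ?thesis by (simp add: ultrapower_def)
qed

lemma ultrafilter_convergent:
  assumes U: "free_ultrafilter U" and bnd: "bounded (range (f :: 'i \<Rightarrow> real))"
  obtains l where "(f \<longlongrightarrow> l) U"
proof -
  from bnd obtain K where "compact K" "range f \<subseteq> K"
    by (meson bounded_subset_cbox_symmetric compact_cbox)
  moreover have "filtermap f U \<noteq> bot"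
    using U by (simp add: free_ultrafilter_def filtermap_bot_iff)
  ultimately obtain l where l: "inf (nhds l) (filtermap f U) \<noteq> bot"
    unfolding compact_filter by (auto simp: eventually_filtermap image_subset_iff)
  have "(f \<longlongrightarrow> l) U"
  proof (rule topological_tendstoI)
    fix S assume S: "open S" "l \<in> S"
    have "\<not> eventually (\<lambda>i. f i \<notin> S) U"
    proof
      assume "eventually (\<lambda>i. f i \<notin> S) U"
      then have "eventually (\<lambda>y. y \<notin> S) (filtermap f U)"
        by (simp add: eventually_filtermap)
      moreover have "eventually (\<lambda>y. y \<in> S) (nhds l)"
        using S by (rule eventually_nhds_in_open)
      ultimately have "eventually (\<lambda>_. False) (inf (nhds l) (filtermap f U))"
        unfolding eventually_inf by blast
      with l show False by (simp add: trivial_limit_def)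
    qed
    with U show "eventually (\<lambda>i. f i \<in> S) U"
      by (auto simp: free_ultrafilter_def)
  qed
  then show ?thesis ..
qed

lemma tendsto_Lim_norm_linf:
  fixes x :: "'a::real_normed_vector linf"
  assumes U: "free_ultrafilter U"
  shows "((\<lambda>n. norm (apply_bcontfun x n)) \<longlongrightarrow> Lim U (\<lambda>n. norm (apply_bcontfun x n))) U"
proof -
  have "bounded (range (\<lambda>n. norm (apply_bcontfun x n)))"
    using bounded_apply_bcontfun[of x] by (simp add: bounded_iff)
  then obtain l where l: "((\<lambda>n. norm (apply_bcontfun x n)) \<longlongrightarrow> l) U"
    using ultrafilter_convergent[OF U] by blast
  moreover have "U \<noteq> bot" using U by (simp add: free_ultrafilter_def)
  ultimately show ?thesis by (simp add: tendsto_Lim)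
qed

lemma ultrapower_norm:
  fixes x :: "'a::real_normed_vector linf"
  assumes U: "free_ultrafilter U"
  shows "ns_norm (ultrapower U) (ultra_class U x) = Lim U (\<lambda>n. norm (apply_bcontfun x n))"
proof -
  have nb: "U \<noteq> bot" using U by (simp add: free_ultrafilter_def)
  have "Lim U (\<lambda>n. norm (apply_bcontfun y n)) = Lim U (\<lambda>n. norm (apply_bcontfun x n))"
    if "y \<in> ultra_class U x" for y
  proof -
    have z: "((\<lambda>n. apply_bcontfun x n - apply_bcontfun y n) \<longlongrightarrow> 0) U"
      using that by (simp add: ultra_rel_iff null_subspace_iff minus_bcontfun.rep_eq)
    have "((\<lambda>n. norm (apply_bcontfun x n) - norm (apply_bcontfun y n)) \<longlongrightarrow> 0) U"
      by (rule Lim_null_comparison[OF _ tendsto_norm_zero[OF z]])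
         (auto intro!: always_eventually norm_triangle_ineq3)
    then have "((\<lambda>n. norm (apply_bcontfun x n)) \<longlongrightarrow> Lim U (\<lambda>n. norm (apply_bcontfun y n))) U"
      using tendsto_add[OF _ tendsto_Lim_norm_linf[OF U, of y]] by fastforce
    then show ?thesis using nb by (simp add: tendsto_Lim)
  qed
  moreover have "x \<in> ultra_class U x"
    using equiv_class_self[OF equiv_ultra_rel] by blast
  ultimately have "(\<lambda>x. Lim U (\<lambda>n. norm (apply_bcontfun x n))) ` ultra_class U x =
      {Lim U (\<lambda>n. norm (apply_bcontfun x n))}"
    by blast
  then show ?thesis by (simp add: ultrapower_def)
qed

end

theory Submission
  imports Defs
begin

text \<open>A representing pair of sequences of an orthogonal pair in the ultrapower is orthogonal in each
  coordinate up to errors that vanish along the ultrafilter. Every almost orthogonal pair lies close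
  to an exactly orthogonal one: by Ekeland's principle on the line through \<open>x\<close> in direction
  \<open>y\<close> one moves \<open>x\<close> slightly to a point where the norm has a small subgradient \<open>s\<close>
  along \<open>y\<close>, and then subtracts from \<open>y\<close> the multiple of \<open>x\<close> that cancels \<open>s\<close>. The
  corrected sequences represent the same classes, so the quotients of the ultrapower are limits
  of quotients of the space.\<close>

section \<open>Minimisers and subgradients of functions on the real line\<close>

lemma attains_min_if_coercive:
  fixes f :: "real \<Rightarrow> real"
  assumes cont: "continuous_on UNIV f" and far: "\<And>t. M < \<bar>t\<bar> \<Longrightarrow> f 0 \<le> f t"
  shows "\<exists>t0. \<forall>t. f t0 \<le> f t"
proof -
  \<comment> \<open>The absolute value puts 0 into the compact interval even when \<open>M\<close>
    is negative.\<close>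
  define N where "N = \<bar>M\<bar>"
  have "\<exists>t0\<in>{-N..N}. \<forall>t\<in>{-N..N}. f t0 \<le> f t"
    by (intro continuous_attains_inf)
       (auto intro: continuous_on_subset[OF cont] simp: N_def)
  then obtain t0 where t0: "\<And>t. \<bar>t\<bar> \<le> N \<Longrightarrow> f t0 \<le> f t"
    by (metis abs_le_iff atLeastAtMost_iff minus_le_iff)
  have "f t0 \<le> f t" for t
  proof (cases "\<bar>t\<bar> \<le> N")
    case False
    then have "f 0 \<le> f t" by (intro far) (simp add: N_def)
    moreover have "f t0 \<le> f 0" by (rule t0) (simp add: N_def)
    ultimately show ?thesis by simp
  qed (rule t0)
  then show ?thesis by blast
qed

text \<open>By convexity the difference quotients at 0 from the left lie below those from the right,
  and any number separating them is a subgradient. The assumption \<open>lower\<close> keeps the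
  left quotients at most \<open>d\<close> and the right ones at least \<open>-d\<close>, so the
  separating number can be taken in \<open>{-d..d}\<close>.\<close>

lemma convex_subgradient_bounded:
  fixes g :: "real \<Rightarrow> real"
  assumes convex: "convex_on UNIV g" and "0 \<le> d"
    and lower: "\<And>t. g 0 - d * \<bar>t\<bar> \<le> g t"
  obtains s where "\<bar>s\<bar> \<le> d" "\<And>t. g 0 + s * t \<le> g t"
proof -
  \<comment> \<open>Inserting \<open>-d\<close> among the left quotients forces the supremum to be
    at least \<open>-d\<close> and preserves the bound by the right quotients.\<close>
  define A where "A = insert (-d) ((\<lambda>t. (g t - g 0) / t) ` {..<0})"
  have slope: "a \<le> (g v - g 0) / v" if "a \<in> A" "0 < v" for a v
  proof -
    consider "a = -d" | u where "u < 0" "a = (g u - g 0) / u"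
      using \<open>a \<in> A\<close> by (auto simp: A_def)
    then show ?thesis
    proof cases
      case 1
      then show ?thesis using lower[of v] \<open>0 < v\<close> by (simp add: field_simps)
    next
      case 2
      \<comment> \<open>These weights write 0 as a convex combination of \<open>u\<close> and
        \<open>v\<close>.\<close>
      have "g ((1 - (-u) / (v - u)) *\<^sub>R u + ((-u) / (v - u)) *\<^sub>R v)
          \<le> (1 - (-u) / (v - u)) * g u + ((-u) / (v - u)) * g v"
        using 2 \<open>0 < v\<close> by (intro convex_onD[OF convex]) (auto simp: field_simps)
      moreover have "(1 - (-u) / (v - u)) *\<^sub>R u + ((-u) / (v - u)) *\<^sub>R v = 0"
        using 2 \<open>0 < v\<close> by (simp add: field_simps)
      moreover have "1 - (-u) / (v - u) = v / (v - u)"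
        using 2 \<open>0 < v\<close> by (simp add: field_simps)
      ultimately have "g 0 \<le> (v * g u + (-u) * g v) / (v - u)"
        by (simp add: diff_divide_distrib)
      then have "g 0 * (v - u) \<le> v * g u - u * g v"
        using 2 \<open>0 < v\<close> by (simp add: pos_le_divide_eq)
      then show ?thesis
        using \<open>u < 0\<close> \<open>0 < v\<close> unfolding 2(2) by (simp add: field_simps)
    qed
  qed
  have bound: "a \<le> d" if "a \<in> A" for a
  proof -
    have "(g u - g 0) / u \<le> d" if "u < 0" for u
      using lower[of u] that by (simp add: field_simps)
    then show ?thesis using that \<open>0 \<le> d\<close> by (auto simp: A_def)
  qed
  define s where "s = Sup A"
  have bdd: "bdd_above A" using bound by (auto simp: bdd_above_def)
  have "-d \<le> s" unfolding s_def by (rule cSup_upper[OF _ bdd]) (simp add: A_def)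
  moreover have "s \<le> d" unfolding s_def by (rule cSup_least) (auto simp: bound, auto simp: A_def)
  moreover have "g 0 + s * t \<le> g t" for t
  proof (cases t "0::real" rule: linorder_cases)
    case less
    then have "(g t - g 0) / t \<le> s"
      unfolding s_def by (intro cSup_upper[OF _ bdd]) (simp add: A_def)
    then show ?thesis using less by (simp add: field_simps)
  next
    case greater
    then have "s \<le> (g t - g 0) / t"
      unfolding s_def by (intro cSup_least) (auto simp: slope, auto simp: A_def)
    then show ?thesis using greater by (simp add: field_simps)
  qed simp
  ultimately show ?thesis by (intro that) (auto simp: abs_le_iff)
qed

section \<open>The norm along a line, and stability of Birkhoff orthogonality\<close>

lemma convex_on_norm_line: "convex_on UNIV (\<lambda>t. norm (x + t *\<^sub>R y))"
proof (rule convex_onI)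
  fix t u v :: real assume t: "0 < t" "t < 1"
  have "x + ((1 - t) *\<^sub>R u + t *\<^sub>R v) *\<^sub>R y
      = (1 - t) *\<^sub>R (x + u *\<^sub>R y) + t *\<^sub>R (x + v *\<^sub>R y)"
    by (simp add: algebra_simps)
  then show "norm (x + ((1 - t) *\<^sub>R u + t *\<^sub>R v) *\<^sub>R y)
      \<le> (1 - t) * norm (x + u *\<^sub>R y) + t * norm (x + v *\<^sub>R y)"
    using norm_triangle_ineq[of "(1 - t) *\<^sub>R (x + u *\<^sub>R y)" "t *\<^sub>R (x + v *\<^sub>R y)"] t by simp
qed simp

lemma birkhoff_orth_type_space:
  "birkhoff_orth type_space x y \<longleftrightarrow> (\<forall>t. norm x \<le> norm (x + t *\<^sub>R y))"
  by (simp add: birkhoff_orth_def type_space_def)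

text \<open>The linear functional with values \<open>norm x\<close> at \<open>x\<close> and
  \<open>s\<close> at \<open>y\<close> vanishes on the corrected vector, and the subgradient
  inequality says that the norm dominates it on points \<open>x + t *\<^sub>R y\<close>. Positive
  rescaling carries this over to the corrected line for small \<open>t\<close>; convexity then makes
  the local minimum global.\<close>

lemma birkhoff_orth_subgradient:
  fixes x y :: "'a::real_normed_vector"
  assumes s: "\<And>t. norm x + s * t \<le> norm (x + t *\<^sub>R y)"
  shows "birkhoff_orth type_space x (y - (s / norm x) *\<^sub>R x)"
proof (cases "x = 0")
  case False
  define c where "c = s / norm x"
  have "norm x \<le> norm (x + t *\<^sub>R (y - c *\<^sub>R x))" for t
  proof -
    let ?h = "\<lambda>t. norm (x + t *\<^sub>R (y - c *\<^sub>R x))"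
    \<comment> \<open>The radius ensures \<open>0 < 1 - t * c\<close>; the added 1 covers
      \<open>c = 0\<close>.\<close>
    have "?h 0 \<le> ?h t" if "t \<in> ball 0 (1 / (\<bar>c\<bar> + 1))" for t
    proof -
      have "\<bar>t\<bar> * (\<bar>c\<bar> + 1) < 1" using that by (simp add: field_simps)
      then have "\<bar>t * c\<bar> < 1" by (simp add: abs_mult algebra_simps)
      then have pos: "0 < 1 - t * c" by linarith
      \<comment> \<open>Since \<open>c * norm x = s\<close>, the loss \<open>t * c * norm x\<close>
        from rescaling is exactly the gain \<open>s * t\<close>.\<close>
      have "norm x = (1 - t * c) * (norm x + s * (t / (1 - t * c)))"
        using pos False by (simp add: field_simps c_def)
      also have "\<dots> \<le> (1 - t * c) * norm (x + (t / (1 - t * c)) *\<^sub>R y)"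
        using pos by (intro mult_left_mono s) simp
      also have "\<dots> = norm ((1 - t * c) *\<^sub>R (x + (t / (1 - t * c)) *\<^sub>R y))"
        using pos by simp
      also have "(1 - t * c) *\<^sub>R (x + (t / (1 - t * c)) *\<^sub>R y) = x + t *\<^sub>R (y - c *\<^sub>R x)"
        using pos by (simp add: scaleR_add_right) (simp add: algebra_simps)
      finally show ?thesis by simp
    qed
    then have "\<forall>t\<in>UNIV. ?h 0 \<le> ?h t"
      by (intro convex_local_global_minimum[OF _ convex_on_norm_line, of "1 / (\<bar>c\<bar> + 1)"] ballI) auto
    then show ?thesis by simp
  qed
  then show ?thesis by (simp add: birkhoff_orth_type_space c_def)
qed (simp add: birkhoff_orth_type_space)

text \<open>A penalty of slope \<open>d\<close> moves the minimiser by at most \<open>e / d\<close>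
  and leaves a subgradient of size at most \<open>d\<close>. The choice \<open>d = sqrt e\<close>
  balances the two errors.\<close>

lemma birkhoff_orth_perturbation:
  fixes x y :: "'a::real_normed_vector"
  assumes approx: "\<And>t. norm x - e \<le> norm (x + t *\<^sub>R y)" and "0 \<le> e"
  obtains x' y' where "birkhoff_orth type_space x' y'"
    "norm (x' - x) \<le> sqrt e * norm y" "norm (y' - y) \<le> sqrt e"
proof (cases "e = 0")
  case True
  then show ?thesis using approx by (intro that[of x y]) (auto simp: birkhoff_orth_type_space)
next
  case False
  define d where "d = sqrt e"
  have d: "0 < d" "d * d = e" using False \<open>0 \<le> e\<close> by (auto simp: d_def)
  text \<open>Penalising the distance to 0 keeps the minimiser close to 0 and makes the slope there small.\<close>
  have "continuous_on UNIV (\<lambda>t. norm (x + t *\<^sub>R y) + d * \<bar>t\<bar>)"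
    by (intro continuous_intros)
  moreover have "norm (x + 0 *\<^sub>R y) + d * \<bar>0\<bar> \<le> norm (x + t *\<^sub>R y) + d * \<bar>t\<bar>"
    if "norm x / d < \<bar>t\<bar>" for t
  proof -
    have "norm x \<le> d * \<bar>t\<bar>" using that d by (simp add: field_simps)
    then show ?thesis
      using add_mono[OF norm_ge_zero[of "x + t *\<^sub>R y"], of "norm x" "d * \<bar>t\<bar>"] by simp
  qed
  ultimately obtain t0 where
    t0: "\<And>t. norm (x + t0 *\<^sub>R y) + d * \<bar>t0\<bar> \<le> norm (x + t *\<^sub>R y) + d * \<bar>t\<bar>"
    using attains_min_if_coercive[of "\<lambda>t. norm (x + t *\<^sub>R y) + d * \<bar>t\<bar>"] by blast
  define x' where "x' = x + t0 *\<^sub>R y"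
  \<comment> \<open>The penalty paid at \<open>t0\<close> is at most the decrease of the norm, which
    \<open>approx\<close> bounds by \<open>e\<close>.\<close>
  have "d * \<bar>t0\<bar> \<le> d * d" using t0[of 0] approx[of t0] d by simp
  then have t0_le: "\<bar>t0\<bar> \<le> d" using d(1) by simp
  have "norm x' - d * \<bar>t\<bar> \<le> norm (x' + t *\<^sub>R y)" for t
  proof -
    have "d * \<bar>t0 + t\<bar> \<le> d * (\<bar>t0\<bar> + \<bar>t\<bar>)" using d by (intro mult_left_mono abs_triangle_ineq) simp
    then show ?thesis using t0[of "t0 + t"] by (simp add: x'_def algebra_simps)
  qed
  then obtain s where s: "\<bar>s\<bar> \<le> d" "\<And>t. norm x' + s * t \<le> norm (x' + t *\<^sub>R y)"
    using convex_subgradient_bounded[OF convex_on_norm_line[of x' y], of d] d by auto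
  show ?thesis
  proof (rule that[of x' "y - (s / norm x') *\<^sub>R x'"])
    show "birkhoff_orth type_space x' (y - (s / norm x') *\<^sub>R x')"
      using s(2) by (rule birkhoff_orth_subgradient)
    show "norm (x' - x) \<le> sqrt e * norm y"
      using t0_le by (simp add: x'_def d_def mult_right_mono)
    \<comment> \<open>The correction has norm \<open>\<bar>s\<bar>\<close>, or is 0 when
      \<open>x' = 0\<close>.\<close>
    show "norm (y - (s / norm x') *\<^sub>R x' - y) \<le> sqrt e"
      using s(1) d by (cases "x' = 0") (auto simp: d_def)
  qed
qed

section \<open>Norms and differences of classes in the ultrapower\<close>

lemma free_ultrafilter_nontrivial: "free_ultrafilter U \<Longrightarrow> U \<noteq> bot"
  by (simp add: free_ultrafilter_def)

lemma ultrapower_norm_eqI: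
  fixes x :: "'a::real_normed_vector linf"
  assumes "free_ultrafilter U" "((\<lambda>n. norm (apply_bcontfun x n)) \<longlongrightarrow> l) U"
  shows "ns_norm (ultrapower U) (ultra_class U x) = l"
  using assms by (simp add: ultrapower_norm tendsto_Lim free_ultrafilter_nontrivial)

lemma tendsto_ultrapower_norm:
  fixes x :: "'a::real_normed_vector linf"
  assumes "free_ultrafilter U"
  shows "((\<lambda>n. norm (apply_bcontfun x n)) \<longlongrightarrow> ns_norm (ultrapower U) (ultra_class U x)) U"
  using tendsto_Lim_norm_linf[OF assms] by (simp add: ultrapower_norm[OF assms])

lemma ultra_class_eq_zero_iff:
  fixes x :: "'a::real_normed_vector linf"
  assumes "free_ultrafilter U"
  shows "ultra_class U x = ultra_class U 0 \<longleftrightarrow> ns_norm (ultrapower U) (ultra_class U x) = 0"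
proof -
  have "ultra_class U x = ultra_class U 0 \<longleftrightarrow> ((\<lambda>n. norm (apply_bcontfun x n)) \<longlongrightarrow> 0) U"
    by (simp add: ultra_class_eq_iff null_subspace_def)
  also have "\<dots> \<longleftrightarrow> ns_norm (ultrapower U) (ultra_class U x) = 0"
    using tendsto_ultrapower_norm[OF assms, of x] ultrapower_norm_eqI[OF assms, of x 0] by auto
  finally show ?thesis .
qed

lemma ultrapower_diff:
  "ns_diff (ultrapower U) (ultra_class U x) (ultra_class U y) = ultra_class U (x - y)"
  by (simp add: ns_diff_def ultrapower_scale ultrapower_add)

section \<open>The supremum, and its lower bound from the diagonal copy of the space\<close>

lemma DR_alpha_type_space:
  "DR_alpha type_space x y = norm ((1 / norm x) *\<^sub>R x - (1 / norm y) *\<^sub>R y)"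
  by (simp add: DR_alpha_def ns_diff_def type_space_def)

lemma DR_beta_type_space:
  "DR_beta type_space x y = norm ((1 / norm y) *\<^sub>R x - (1 / norm x) *\<^sub>R y)"
  by (simp add: DR_beta_def ns_diff_def type_space_def)

lemma DR_B_upper:
  assumes "x \<in> ns_carrier Z" "x \<noteq> ns_zero Z" "y \<in> ns_carrier Z" "y \<noteq> ns_zero Z"
    and "birkhoff_orth Z x y" "DR_beta Z x y \<noteq> 0"
  shows "ereal (DR_alpha Z x y / DR_beta Z x y) \<le> DR_B Z"
  unfolding DR_B_def by (rule Sup_upper) (use assms in blast)

lemma DR_B_least:
  assumes "\<And>x y. \<lbrakk>x \<in> ns_carrier Z; x \<noteq> ns_zero Z; y \<in> ns_carrier Z; y \<noteq> ns_zero Z;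
      birkhoff_orth Z x y; DR_beta Z x y \<noteq> 0\<rbrakk> \<Longrightarrow> ereal (DR_alpha Z x y / DR_beta Z x y) \<le> B"
  shows "DR_B Z \<le> B"
  unfolding DR_B_def by (rule Sup_least) (use assms in blast)

text \<open>Constant sequences embed the space linearly and isometrically, so every admissible pair
  reappears in the ultrapower with the same quotient.\<close>

lemma DR_B_le_DR_B_ultrapower:
  assumes U: "free_ultrafilter U"
  shows "DR_B (type_space :: 'a::real_normed_vector normed_structure)
    \<le> DR_B (ultrapower U :: 'a linf set normed_structure)"
proof (rule DR_B_least)
  fix x y :: 'a
  assume x: "x \<noteq> ns_zero type_space" and y: "y \<noteq> ns_zero type_space"
    and orth: "birkhoff_orth type_space x y" and beta: "DR_beta type_space x y \<noteq> 0"
  let ?Z = "ultrapower U :: 'a linf set normed_structure"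
  define J where "J z = ultra_class U (const_bcontfun z)" for z :: 'a
  have norm: "ns_norm ?Z (J z) = norm z" for z
    unfolding J_def by (rule ultrapower_norm_eqI[OF U]) (simp add: const_bcontfun.rep_eq)
  have add: "ns_add ?Z (J u) (J v) = J (u + v)" for u v
    by (auto simp: J_def ultrapower_add const_bcontfun.rep_eq plus_bcontfun.rep_eq
        intro!: arg_cong[where f = "ultra_class U"] bcontfun_eqI)
  have scale: "ns_scale ?Z c (J u) = J (c *\<^sub>R u)" for c u
    by (auto simp: J_def ultrapower_scale const_bcontfun.rep_eq scaleR_bcontfun.rep_eq
        intro!: arg_cong[where f = "ultra_class U"] bcontfun_eqI)
  have alpha_J: "DR_alpha ?Z (J x) (J y) = DR_alpha type_space x y"
    by (simp add: DR_alpha_def ns_diff_def norm add scale) (simp add: type_space_def)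
  have beta_J: "DR_beta ?Z (J x) (J y) = DR_beta type_space x y"
    by (simp add: DR_beta_def ns_diff_def norm add scale) (simp add: type_space_def)
  have nz: "J z \<noteq> ns_zero ?Z" if "z \<noteq> ns_zero type_space" for z
    using that ultra_class_eq_zero_iff[OF U, of "const_bcontfun z"] norm[of z]
    by (simp add: ultrapower_zero J_def type_space_def)
  have "ereal (DR_alpha ?Z (J x) (J y) / DR_beta ?Z (J x) (J y)) \<le> DR_B ?Z"
  proof (rule DR_B_upper)
    show "J x \<in> ns_carrier ?Z" "J y \<in> ns_carrier ?Z"
      by (auto simp: J_def ultrapower_carrier)
    show "birkhoff_orth ?Z (J x) (J y)"
      using orth by (simp add: birkhoff_orth_def norm add scale) (simp add: type_space_def)
  qed (use nz x y beta beta_J in auto)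
  then show "ereal (DR_alpha type_space x y / DR_beta type_space x y) \<le> DR_B ?Z"
    by (simp add: alpha_J beta_J)
qed

section \<open>Limits of asymptotically equal sequences, and lifting of orthogonal pairs\<close>

lemma tendsto_scaleR_close:
  fixes u v :: "'i \<Rightarrow> 'a::real_normed_vector"
  assumes c: "(c \<longlongrightarrow> l) F" and u: "((\<lambda>n. norm (u n)) \<longlongrightarrow> m) F"
    and uv: "((\<lambda>n. u n - v n) \<longlongrightarrow> 0) F"
  shows "((\<lambda>n. c n *\<^sub>R u n - l *\<^sub>R v n) \<longlongrightarrow> 0) F"
proof (rule Lim_null_comparison)
  have "norm (c n *\<^sub>R u n - l *\<^sub>R v n) \<le> \<bar>c n - l\<bar> * norm (u n) + \<bar>l\<bar> * norm (u n - v n)" for n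
  proof -
    have "c n *\<^sub>R u n - l *\<^sub>R v n = (c n - l) *\<^sub>R u n + l *\<^sub>R (u n - v n)"
      by (simp add: algebra_simps)
    then show ?thesis
      using norm_triangle_ineq[of "(c n - l) *\<^sub>R u n" "l *\<^sub>R (u n - v n)"] by simp
  qed
  then show "\<forall>\<^sub>F n in F. norm (c n *\<^sub>R u n - l *\<^sub>R v n)
      \<le> \<bar>c n - l\<bar> * norm (u n) + \<bar>l\<bar> * norm (u n - v n)" by simp
  have "((\<lambda>n. \<bar>c n - l\<bar> * norm (u n) + \<bar>l\<bar> * norm (u n - v n)) \<longlongrightarrow> \<bar>l - l\<bar> * m + \<bar>l\<bar> * norm (0::'a)) F"
    by (intro tendsto_intros c u uv)
  then show "((\<lambda>n. \<bar>c n - l\<bar> * norm (u n) + \<bar>l\<bar> * norm (u n - v n)) \<longlongrightarrow> 0) F" by simp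
qed

lemma tendsto_norm_close:
  fixes u v :: "'i \<Rightarrow> 'a::real_normed_vector"
  assumes v: "((\<lambda>n. norm (v n)) \<longlongrightarrow> m) F" and uv: "((\<lambda>n. u n - v n) \<longlongrightarrow> 0) F"
  shows "((\<lambda>n. norm (u n)) \<longlongrightarrow> m) F"
proof -
  have "((\<lambda>n. norm (u n) - norm (v n)) \<longlongrightarrow> 0) F"
    by (rule Lim_null_comparison[OF _ tendsto_norm_zero[OF uv]])
       (auto intro!: always_eventually norm_triangle_ineq3)
  from tendsto_add[OF this v] show ?thesis by simp
qed

text \<open>Serves for both \<open>DR_alpha\<close> and \<open>DR_beta\<close>: vectors are
  perturbed and, at the same time, the reciprocals of their norms are replaced by limits.\<close>

lemma tendsto_norm_scaleR_diff_close:
  fixes u v u' v' :: "'i \<Rightarrow> 'a::real_normed_vector"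
  assumes "(c \<longlongrightarrow> k) F" "((\<lambda>n. norm (u' n)) \<longlongrightarrow> a) F" "((\<lambda>n. u' n - u n) \<longlongrightarrow> 0) F"
    and "(d \<longlongrightarrow> l) F" "((\<lambda>n. norm (v' n)) \<longlongrightarrow> b) F" "((\<lambda>n. v' n - v n) \<longlongrightarrow> 0) F"
    and "((\<lambda>n. norm (k *\<^sub>R u n - l *\<^sub>R v n)) \<longlongrightarrow> m) F"
  shows "((\<lambda>n. norm (c n *\<^sub>R u' n - d n *\<^sub>R v' n)) \<longlongrightarrow> m) F"
proof (rule tendsto_norm_close)
  have "((\<lambda>n. (c n *\<^sub>R u' n - k *\<^sub>R u n) - (d n *\<^sub>R v' n - l *\<^sub>R v n)) \<longlongrightarrow> 0 - 0) F"
    by (intro tendsto_diff tendsto_scaleR_close[of c k F u' a u] tendsto_scaleR_close[of d l F v' b v] assms)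
  then show "((\<lambda>n. (c n *\<^sub>R u' n - d n *\<^sub>R v' n) - (k *\<^sub>R u n - l *\<^sub>R v n)) \<longlongrightarrow> 0) F"
    by (simp add: algebra_simps)
qed (rule assms)

text \<open>Orthogonality in the ultrapower controls one fixed scalar at a time, whereas a bound
  uniform in \<open>t\<close> is wanted. The coordinatewise minimisers are bounded, so they converge
  along \<open>U\<close> to some \<open>l\<close>, and orthogonality at the single scalar
  \<open>l\<close> controls them all.\<close>

lemma ultrapower_birkhoff_orth_approx:
  fixes x y :: "'a::real_normed_vector linf"
  assumes U: "free_ultrafilter U"
    and orth: "birkhoff_orth (ultrapower U) (ultra_class U x) (ultra_class U y)"
    and y: "ultra_class U y \<noteq> ns_zero (ultrapower U)"
  obtains e where "(e \<longlongrightarrow> 0) U" "\<And>n. 0 \<le> e n"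
    "\<forall>\<^sub>F n in U. \<forall>t. norm (apply_bcontfun x n) - e n
       \<le> norm (apply_bcontfun x n + t *\<^sub>R apply_bcontfun y n)"
proof -
  define X Y where "X = apply_bcontfun x" and "Y = apply_bcontfun y"
  define a b where "a = ns_norm (ultrapower U) (ultra_class U x)"
    and "b = ns_norm (ultrapower U) (ultra_class U y)"
  have X: "((\<lambda>n. norm (X n)) \<longlongrightarrow> a) U" and Y: "((\<lambda>n. norm (Y n)) \<longlongrightarrow> b) U"
    unfolding X_def Y_def a_def b_def by (rule tendsto_ultrapower_norm[OF U])+
  have nb: "U \<noteq> bot" using U by (rule free_ultrafilter_nontrivial)
  have "b \<noteq> 0" using y ultra_class_eq_zero_iff[OF U, of y] by (simp add: ultrapower_zero b_def)
  moreover have "0 \<le> b" by (rule tendsto_lowerbound[OF Y _ nb]) simp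
  ultimately have b: "0 < b" by simp
  obtain K where K: "\<And>n. norm (X n) \<le> K"
    using bounded_apply_bcontfun[of x] by (auto simp: bounded_iff X_def)
  obtain L where L: "\<And>n. norm (Y n) \<le> L"
    using bounded_apply_bcontfun[of y] by (auto simp: bounded_iff Y_def)
  \<comment> \<open>If \<open>\<bar>t\<bar>\<close> exceeds \<open>4 * K / b\<close> and
    \<open>norm (Y n)\<close> exceeds \<open>b / 2\<close>, then \<open>t *\<^sub>R Y n\<close> is
    longer than \<open>2 * K\<close> and the sum is longer than \<open>X n\<close>. Where
    \<open>Y n\<close> is too short, 0 serves as default.\<close>
  have "\<exists>t. \<bar>t\<bar> \<le> 4 * K / b \<and> norm (X n + t *\<^sub>R Y n) \<le> norm (X n) \<and>
      (b / 2 < norm (Y n) \<longrightarrow> (\<forall>u. norm (X n + t *\<^sub>R Y n) \<le> norm (X n + u *\<^sub>R Y n)))" for n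
  proof (cases "b / 2 < norm (Y n)")
    case False
    have "0 \<le> K" using K[of n] norm_ge_zero[of "X n"] by linarith
    then show ?thesis using False b by (intro exI[of _ 0]) simp
  next
    case True
    have far: "norm (X n) < norm (X n + t *\<^sub>R Y n)" if "4 * K / b < \<bar>t\<bar>" for t
    proof -
      have "2 * K < \<bar>t\<bar> * (b / 2)" using that b by (simp add: field_simps)
      also have "\<dots> \<le> \<bar>t\<bar> * norm (Y n)" using True by (intro mult_left_mono) auto
      also have "\<dots> = norm (t *\<^sub>R Y n)" by simp
      also have "\<dots> \<le> norm (X n + t *\<^sub>R Y n) + norm (X n)"
        using norm_triangle_ineq4[of "X n + t *\<^sub>R Y n" "X n"] by simp
      finally show ?thesis using K[of n] by simp
    qed
    have "continuous_on UNIV (\<lambda>t. norm (X n + t *\<^sub>R Y n))" by (intro continuous_intros)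
    then obtain t where t: "\<And>u. norm (X n + t *\<^sub>R Y n) \<le> norm (X n + u *\<^sub>R Y n)"
      using attains_min_if_coercive[of "\<lambda>t. norm (X n + t *\<^sub>R Y n)" "4 * K / b"] far
      by (auto intro: less_imp_le)
    moreover have "\<not> 4 * K / b < \<bar>t\<bar>" using far[of t] t[of 0] by auto
    ultimately show ?thesis using t[of 0] by (intro exI[of _ t]) auto
  qed
  then obtain t where t: "\<And>n. \<bar>t n\<bar> \<le> 4 * K / b"
      "\<And>n. norm (X n + t n *\<^sub>R Y n) \<le> norm (X n)"
      "\<And>n u. b / 2 < norm (Y n) \<Longrightarrow> norm (X n + t n *\<^sub>R Y n) \<le> norm (X n + u *\<^sub>R Y n)"
    by metis
  have "bounded (range t)" using t(1) by (auto simp: bounded_iff)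
  then obtain l where l: "(t \<longlongrightarrow> l) U" by (rule ultrafilter_convergent[OF U])
  define m where "m = ns_norm (ultrapower U) (ultra_class U (x + l *\<^sub>R y))"
  have "((\<lambda>n. norm (apply_bcontfun (x + l *\<^sub>R y) n)) \<longlongrightarrow> m) U"
    unfolding m_def by (rule tendsto_ultrapower_norm[OF U])
  then have "((\<lambda>n. norm (X n + l *\<^sub>R Y n)) \<longlongrightarrow> m) U"
    by (simp add: X_def Y_def plus_bcontfun.rep_eq scaleR_bcontfun.rep_eq)
  moreover have "((\<lambda>n. t n *\<^sub>R Y n - l *\<^sub>R Y n) \<longlongrightarrow> 0) U"
    by (rule tendsto_scaleR_close[OF l Y]) simp
  then have "((\<lambda>n. (X n + t n *\<^sub>R Y n) - (X n + l *\<^sub>R Y n)) \<longlongrightarrow> 0) U" by simp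
  ultimately have tm: "((\<lambda>n. norm (X n + t n *\<^sub>R Y n)) \<longlongrightarrow> m) U"
    by (rule tendsto_norm_close)
  have "a \<le> m"
    using orth by (simp add: birkhoff_orth_def ultrapower_scale ultrapower_add a_def m_def)
  moreover have "m \<le> a" by (rule tendsto_le[OF nb X tm]) (simp add: t(2))
  ultimately have "a - m = 0" by simp
  \<comment> \<open>This is the depth to which the line through \<open>X n\<close> dips below
    \<open>norm (X n)\<close> when \<open>Y n\<close> is long enough; its limit is
    \<open>a - m\<close>.\<close>
  define e where "e n = norm (X n) - norm (X n + t n *\<^sub>R Y n)" for n
  show ?thesis
  proof (rule that[of e])
    show "(e \<longlongrightarrow> 0) U"
      using tendsto_diff[OF X tm] \<open>a - m = 0\<close> by (simp add: e_def[abs_def])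
    show "0 \<le> e n" for n using t(2) by (simp add: e_def)
    have "\<forall>\<^sub>F n in U. b / 2 < norm (Y n)"
      using order_tendstoD(1)[OF Y, of "b / 2"] b by simp
    then show "\<forall>\<^sub>F n in U. \<forall>t. norm (apply_bcontfun x n) - e n
       \<le> norm (apply_bcontfun x n + t *\<^sub>R apply_bcontfun y n)"
      by eventually_elim (use t(3) in \<open>auto simp: e_def X_def Y_def\<close>)
  qed
qed

text \<open>The perturbation is applied in each coordinate. Its errors
  \<open>sqrt (e n) * norm (apply_bcontfun y n)\<close> and \<open>sqrt (e n)\<close> vanish along
  \<open>U\<close> because the norms of the second sequence converge.\<close>

lemma ultrapower_birkhoff_orth_lift:
  fixes x y :: "'a::real_normed_vector linf"
  assumes U: "free_ultrafilter U"
    and orth: "birkhoff_orth (ultrapower U) (ultra_class U x) (ultra_class U y)"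
    and y: "ultra_class U y \<noteq> ns_zero (ultrapower U)"
  obtains x' y' :: "nat \<Rightarrow> 'a" where "\<forall>\<^sub>F n in U. birkhoff_orth type_space (x' n) (y' n)"
    "((\<lambda>n. x' n - apply_bcontfun x n) \<longlongrightarrow> 0) U" "((\<lambda>n. y' n - apply_bcontfun y n) \<longlongrightarrow> 0) U"
proof -
  obtain e where e: "(e \<longlongrightarrow> 0) U" "\<And>n. 0 \<le> e n"
    and approx: "\<forall>\<^sub>F n in U. \<forall>t. norm (apply_bcontfun x n) - e n
       \<le> norm (apply_bcontfun x n + t *\<^sub>R apply_bcontfun y n)"
    using ultrapower_birkhoff_orth_approx[OF assms] by blast
  define Q where "Q n p \<longleftrightarrow> birkhoff_orth type_space (fst p) (snd p) \<and>
      norm (fst p - apply_bcontfun x n) \<le> sqrt (e n) * norm (apply_bcontfun y n) \<and>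
      norm (snd p - apply_bcontfun y n) \<le> sqrt (e n)" for n and p :: "'a \<times> 'a"
  \<comment> \<open>Both vectors are chosen together. Where no suitable pair exists the value is
    arbitrary, which is harmless because all conclusions are along \<open>U\<close>.\<close>
  define p where "p n = (SOME p. Q n p)" for n
  have Q: "\<forall>\<^sub>F n in U. Q n (p n)"
    using approx
  proof eventually_elim
    case (elim n)
    then have "\<exists>x' y'. Q n (x', y')"
      unfolding Q_def fst_conv snd_conv by (metis birkhoff_orth_perturbation e(2))
    then obtain x' y' where "Q n (x', y')" by blast
    then show ?case unfolding p_def by (rule someI)
  qed
  have sqrt: "((\<lambda>n. sqrt (e n)) \<longlongrightarrow> 0) U" using tendsto_real_sqrt[OF e(1)] by simp
  show ?thesis
  proof (rule that[of "\<lambda>n. fst (p n)" "\<lambda>n. snd (p n)"])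
    show "\<forall>\<^sub>F n in U. birkhoff_orth type_space (fst (p n)) (snd (p n))"
      using Q by eventually_elim (simp add: Q_def)
    show "((\<lambda>n. snd (p n) - apply_bcontfun y n) \<longlongrightarrow> 0) U"
      by (rule Lim_null_comparison[OF _ sqrt]) (use Q in \<open>auto simp: Q_def elim: eventually_mono\<close>)
    have "((\<lambda>n. sqrt (e n) * norm (apply_bcontfun y n)) \<longlongrightarrow> 0) U"
      using tendsto_mult[OF sqrt tendsto_ultrapower_norm[OF U, of y]] by simp
    then show "((\<lambda>n. fst (p n) - apply_bcontfun x n) \<longlongrightarrow> 0) U"
      by (rule Lim_null_comparison[rotated]) (use Q in \<open>auto simp: Q_def elim: eventually_mono\<close>)
  qed
qed

section \<open>The upper bound for the ultrapower\<close>

lemma DR_B_ultrapower_le_DR_B: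
  assumes U: "free_ultrafilter U"
  shows "DR_B (ultrapower U :: 'a::real_normed_vector linf set normed_structure)
    \<le> DR_B (type_space :: 'a normed_structure)"
proof (rule DR_B_least)
  let ?Z = "ultrapower U :: 'a linf set normed_structure"
  let ?T = "type_space :: 'a normed_structure"
  fix A B
  assume "A \<in> ns_carrier ?Z" "B \<in> ns_carrier ?Z"
    and nz: "A \<noteq> ns_zero ?Z" "B \<noteq> ns_zero ?Z"
    and orth: "birkhoff_orth ?Z A B" and beta: "DR_beta ?Z A B \<noteq> 0"
  then obtain x y where A: "A = ultra_class U x" and B: "B = ultra_class U y"
    by (auto simp: ultrapower_carrier)
  obtain x' y' where orth': "\<forall>\<^sub>F n in U. birkhoff_orth ?T (x' n) (y' n)"
    and x': "((\<lambda>n. x' n - apply_bcontfun x n) \<longlongrightarrow> 0) U"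
    and y': "((\<lambda>n. y' n - apply_bcontfun y n) \<longlongrightarrow> 0) U"
    using ultrapower_birkhoff_orth_lift[OF U, of x y] orth nz unfolding A B by metis
  define a b where "a = ns_norm ?Z A" and "b = ns_norm ?Z B"
  have ab: "a \<noteq> 0" "b \<noteq> 0"
    using nz ultra_class_eq_zero_iff[OF U] unfolding A B a_def b_def ultrapower_zero by metis+
  \<comment> \<open>The lifted sequences are not known to be bounded and define no classes, so
    limits are computed by comparison with \<open>x\<close> and \<open>y\<close>.\<close>
  have norm_x': "((\<lambda>n. norm (x' n)) \<longlongrightarrow> a) U"
    unfolding a_def A by (rule tendsto_norm_close[OF tendsto_ultrapower_norm[OF U] x'])
  have norm_y': "((\<lambda>n. norm (y' n)) \<longlongrightarrow> b) U"
    unfolding b_def B by (rule tendsto_norm_close[OF tendsto_ultrapower_norm[OF U] y'])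
  \<comment> \<open>The scalars are \<open>1 / a\<close>, \<open>1 / b\<close> for
    \<open>DR_alpha\<close>, and the same in exchanged order for \<open>DR_beta\<close>.\<close>
  have lim: "((\<lambda>n. norm (k *\<^sub>R apply_bcontfun x n - l *\<^sub>R apply_bcontfun y n))
      \<longlongrightarrow> ns_norm ?Z (ns_diff ?Z (ns_scale ?Z k A) (ns_scale ?Z l B))) U" for k l
    using tendsto_ultrapower_norm[OF U, of "k *\<^sub>R x - l *\<^sub>R y"]
    by (simp add: A B ultrapower_scale ultrapower_diff minus_bcontfun.rep_eq scaleR_bcontfun.rep_eq)
  have inverse_x': "((\<lambda>n. 1 / norm (x' n)) \<longlongrightarrow> 1 / a) U"
    and inverse_y': "((\<lambda>n. 1 / norm (y' n)) \<longlongrightarrow> 1 / b) U"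
    by (intro tendsto_divide tendsto_const norm_x' norm_y' ab)+
  have alpha_lim: "((\<lambda>n. DR_alpha ?T (x' n) (y' n)) \<longlongrightarrow> DR_alpha ?Z A B) U"
    unfolding DR_alpha_type_space
    by (rule tendsto_norm_scaleR_diff_close[OF inverse_x' norm_x' x' inverse_y' norm_y' y'])
       (unfold DR_alpha_def a_def b_def, rule lim)
  have beta_lim: "((\<lambda>n. DR_beta ?T (x' n) (y' n)) \<longlongrightarrow> DR_beta ?Z A B) U"
    unfolding DR_beta_type_space
    by (rule tendsto_norm_scaleR_diff_close[OF inverse_y' norm_x' x' inverse_x' norm_y' y'])
       (unfold DR_beta_def a_def b_def, rule lim)
  have "((\<lambda>n. ereal (DR_alpha ?T (x' n) (y' n) / DR_beta ?T (x' n) (y' n)))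
      \<longlongrightarrow> ereal (DR_alpha ?Z A B / DR_beta ?Z A B)) U"
    by (intro tendsto_ereal tendsto_divide alpha_lim beta_lim beta)
  \<comment> \<open>The nonzero limits make both vectors and \<open>DR_beta\<close> nonzero along
    \<open>U\<close>, so the coordinate pairs are admissible in the supremum.\<close>
  moreover have "\<forall>\<^sub>F n in U. ereal (DR_alpha ?T (x' n) (y' n) / DR_beta ?T (x' n) (y' n)) \<le> DR_B ?T"
    using orth' tendsto_imp_eventually_ne[OF norm_x' ab(1)]
      tendsto_imp_eventually_ne[OF norm_y' ab(2)] tendsto_imp_eventually_ne[OF beta_lim beta]
    by eventually_elim (rule DR_B_upper; simp add: type_space_def)
  ultimately show "ereal (DR_alpha ?Z A B / DR_beta ?Z A B) \<le> DR_B ?T"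
    by (rule tendsto_upperbound) (rule free_ultrafilter_nontrivial[OF U])
qed

theorem theorem3p6:
  fixes U :: "nat filter"
  assumes "\<exists>B :: 'a::banach set. independent B \<and> card B = 2"
    and "free_ultrafilter U"
  shows "DR_B (ultrapower U :: 'a linf set normed_structure)
    = DR_B (type_space :: 'a normed_structure)"
  using DR_B_ultrapower_le_DR_B[OF assms(2)] DR_B_le_DR_B_ultrapower[OF assms(2)]
  by (rule antisym)

end
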